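(* Let $A$ be a bounded linear operator on a complex Banach space $X$ and let $m\in\mathbb{N}$. Then $\lim_{n\to\infty}\|\mathcal{M}_m(A)^n\|=0$ if and only if the spectrum $\sigma(A)$ is contained in $\mathrm{MARS}_m$.
   Context: $\mathbb{N}=\{1,2,\dots\}$. For a bounded linear operator $A$ on $X$, $\mathcal{M}_m(A)$ is the bounded linear operator on $X^m$ (with any of the usual equivalent product norms) given by the $m\times m$ operator matrix whose $i$-th row, for $1\le i\le m-1$, has the identity in column $i+1$ and zeros elsewhere, and whose last row has all entries equal to $\frac1m A$; i.e. $\mathcal{M}_m(A)(v_1,\dots,v_m)=\bigl(v_2,\dots,v_m,\frac1m\sum_{j=1}^m Av_j\bigr)$. For $a\in\mathbb{C}$, $\mathcal{M}_m(a)\in\mathbb{C}^{m\times m}$ is the corresponding matrix with $X=\mathbb{C}$ and $A$ multiplication by $a$. $\mathrm{MARS}_m:=\{a\in\mathbb{C}:\sigma(\mathcal{M}_m(a))\subseteq B_1(0)\}$, where $\sigma(\cdot)$ denotes the spectrum and $B_1(0)=\{z\in\mathbb{C}:|z|<1\}$. *)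

theory Defs
  imports "HOL-Analysis.Analysis" "Jordan_Normal_Form.Spectral_Radius"
begin

text \<open>
  The distribution has no class of complex normed spaces. A complex Banach space is a real
  Banach space with a complex scalar multiplication that extends the real one and for which
  the norm is absolutely homogeneous.
\<close>

class cbanach = banach +
  fixes scaleC :: "complex \<Rightarrow> 'a \<Rightarrow> 'a"  (infixr \<open>*\<^sub>C\<close> 75)
  assumes scaleC_add_right: "c *\<^sub>C (x + y) = c *\<^sub>C x + c *\<^sub>C y"
    and scaleC_add_left: "(c + d) *\<^sub>C x = c *\<^sub>C x + d *\<^sub>C x"
    and scaleC_scaleC: "c *\<^sub>C (d *\<^sub>C x) = (c * d) *\<^sub>C x"
    and scaleC_one: "1 *\<^sub>C x = x"
    and scaleC_of_real: "complex_of_real r *\<^sub>C x = r *\<^sub>R x"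
    and norm_scaleC: "norm (c *\<^sub>C x) = cmod c * norm x"

instantiation complex :: cbanach
begin
definition scaleC_complex :: "complex \<Rightarrow> complex \<Rightarrow> complex" where
  "scaleC_complex c x = c * x"
instance
  by standard (simp_all add: scaleC_complex_def algebra_simps norm_mult scaleR_conv_of_real)
end

definition bounded_clinear :: "('a::cbanach \<Rightarrow> 'a) \<Rightarrow> bool" where
  "bounded_clinear A \<longleftrightarrow> bounded_linear A \<and> (\<forall>c x. A (c *\<^sub>C x) = c *\<^sub>C A x)"

definition op_spectrum :: "('a::cbanach \<Rightarrow> 'a) \<Rightarrow> complex set" where
  "op_spectrum A = {z. \<not> (\<exists>B. bounded_clinear B \<and>
     (\<forall>x. B (z *\<^sub>C x - A x) = x) \<and> (\<forall>x. z *\<^sub>C B x - A (B x) = x))}"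

text \<open>
  The power \<open>X\<^sup>m\<close> for a natural number \<open>m\<close>: a tuple \<open>(v\<^sub>1, \<dots>, v\<^sub>m)\<close> is the function with
  values \<open>v 0, \<dots>, v (m - 1)\<close> that vanishes from \<open>m\<close> on, so all indices are shifted by one.
\<close>

definition prod_space :: "nat \<Rightarrow> (nat \<Rightarrow> 'a::zero) set" where
  "prod_space m = {v. \<forall>i\<ge>m. v i = 0}"

text \<open>
  The norms on \<open>X\<^sup>m\<close> that are equivalent to the \<open>1\<close>-product norm, hence to the maximum norm and
  to every other \<open>p\<close>-product norm. Nothing is required of \<open>N\<close> outside \<open>prod_space m\<close>;
  definiteness follows from the lower bound.
\<close>

definition product_norm :: "nat \<Rightarrow> ((nat \<Rightarrow> 'a::cbanach) \<Rightarrow> real) \<Rightarrow> bool" where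
  "product_norm m N \<longleftrightarrow>
     (\<forall>u\<in>prod_space m. \<forall>v\<in>prod_space m. N (\<lambda>i. u i + v i) \<le> N u + N v) \<and>
     (\<forall>c. \<forall>v\<in>prod_space m. N (\<lambda>i. c *\<^sub>C v i) = cmod c * N v) \<and>
     (\<exists>a>0. \<exists>b. \<forall>v\<in>prod_space m.
        a * (\<Sum>i<m. norm (v i)) \<le> N v \<and> N v \<le> b * (\<Sum>i<m. norm (v i)))"

lemma product_norm_sum: "product_norm m (\<lambda>v. \<Sum>i<m. norm (v i))"
proof -
  have "(\<Sum>i<m. norm (u i + v i)) \<le> (\<Sum>i<m. norm (u i)) + (\<Sum>i<m. norm (v i))"
    for u v :: "nat \<Rightarrow> 'a"
    unfolding sum.distrib[symmetric] by (intro sum_mono norm_triangle_ineq)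
  moreover have "(\<Sum>i<m. norm (c *\<^sub>C v i)) = cmod c * (\<Sum>i<m. norm (v i))"
    for c and v :: "nat \<Rightarrow> 'a"
    by (simp only: norm_scaleC sum_distrib_left)
  moreover have "\<exists>a>0. \<exists>b. \<forall>v\<in>prod_space m. a * (\<Sum>i<m. norm (v i)) \<le> (\<Sum>i<m. norm (v i)) \<and>
      (\<Sum>i<m. norm (v i)) \<le> b * (\<Sum>i<m. norm (v i :: 'a))"
    by (intro exI[of _ "1::real"] conjI) simp_all
  ultimately show ?thesis
    unfolding product_norm_def by blast
qed

definition op_norm ::
  "nat \<Rightarrow> ((nat \<Rightarrow> 'a::cbanach) \<Rightarrow> real) \<Rightarrow> ((nat \<Rightarrow> 'a) \<Rightarrow> (nat \<Rightarrow> 'a)) \<Rightarrow> real" where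
  "op_norm m N T = (SUP v\<in>{v \<in> prod_space m. N v \<le> 1}. N (T v))"

definition mars_op :: "nat \<Rightarrow> ('a::cbanach \<Rightarrow> 'a) \<Rightarrow> (nat \<Rightarrow> 'a) \<Rightarrow> (nat \<Rightarrow> 'a)" where
  "mars_op m A v = (\<lambda>i. if i + 1 < m then v (i + 1)
                        else if i + 1 = m then (1 / real m) *\<^sub>R (\<Sum>j<m. A (v j))
                        else 0)"

definition mars_mat :: "nat \<Rightarrow> complex \<Rightarrow> complex mat" where
  "mars_mat m a = mat m m (\<lambda>(i, j). if i + 1 = m then a / of_nat m
                                    else if j = i + 1 then 1 else 0)"

lemma mars_mat_mult_vec:
  "mars_mat m a *\<^sub>v vec m v = vec m (mars_op m (\<lambda>x. a * x) v)"
proof (rule eq_vecI)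
  fix i assume "i < dim_vec (vec m (mars_op m (\<lambda>x. a * x) v))"
  then have i: "i < m" by simp
  have "vec_index (mars_mat m a *\<^sub>v vec m v) i =
      (\<Sum>j<m. (if i + 1 = m then a / of_nat m else if j = i + 1 then 1 else 0) * v j)"
    using i by (simp add: mars_mat_def scalar_prod_def lessThan_atLeast0)
  also have "\<dots> = mars_op m (\<lambda>x. a * x) v i"
  proof (cases "i + 1 = m")
    case True
    then show ?thesis
      by (auto simp: mars_op_def scaleR_conv_of_real sum_distrib_left intro!: sum.cong)
  next
    case False
    then have "i + 1 < m" using i by simp
    then show ?thesis
      by (simp add: mars_op_def if_distrib[of "\<lambda>x. x * _"] cong: if_cong)
  qed
  finally show "vec_index (mars_mat m a *\<^sub>v vec m v) i = vec_index (vec m (mars_op m (\<lambda>x. a * x) v)) i"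
    using i by simp
qed (simp add: mars_mat_def)

definition MARS :: "nat \<Rightarrow> complex set" where
  "MARS m = {a. spectrum (mars_mat m a) \<subseteq> {z. cmod z < 1}}"

end

theory Submission
  imports Defs
begin

text \<open>
  The operator norms of the powers of \<open>T\<close> tend to \<open>0\<close> iff the spectrum of \<open>T\<close> lies in the open
  unit disk. One direction is the Neumann series. For the other no Banach-valued contour integral
  is needed: averaging the resolvents \<open>(1 - r \<omega> T)\<^sup>-\<^sup>1\<close> over the \<open>n\<close>-th roots of unity \<open>\<omega>\<close> gives
  \<open>(1 - r\<^sup>n T\<^sup>n)\<^sup>-\<^sup>1\<close>, and the resolvents are uniformly Lipschitz on the closed disk; so if some
  \<open>r\<^sup>n T\<^sup>n\<close> is a contraction by \<open>1/3\<close>, the same holds (for another \<open>n\<close>) with \<open>r + \<delta>\<close> in place of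
  \<open>r\<close>, where \<open>\<delta>\<close> does not depend on \<open>r\<close>, and finitely many steps lead from \<open>r = 0\<close> to \<open>r = 1\<close>.

  For \<open>T = \<M>\<^sub>m(A)\<close> and \<open>z \<noteq> 0\<close>, elimination shows that \<open>z - T\<close> is invertible iff
  \<open>z\<^sup>m - (1 + z + \<dots> + z\<^bsup>m-1\<^esup>) A / m\<close> is. If the scalar factor of \<open>A\<close> vanishes this always holds;
  otherwise it fails iff the single \<open>a\<close> for which \<open>z\<close> is an eigenvalue of \<open>\<M>\<^sub>m(a)\<close> lies in \<open>\<sigma>(A)\<close>.
\<close>

section \<open>Powers of an operator with spectrum in the open unit disk\<close>

interpretation scaleC: vector_space "scaleC :: complex \<Rightarrow> 'a \<Rightarrow> 'a::cbanach"
  by standard (simp_all add: scaleC_add_right scaleC_add_left scaleC_scaleC scaleC_one)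

lemma bounded_linear_scaleC: "bounded_linear (\<lambda>x :: 'a::cbanach. c *\<^sub>C x)"
proof (rule bounded_linear_intro)
  fix r :: real and x :: 'a
  show "c *\<^sub>C (r *\<^sub>R x) = r *\<^sub>R (c *\<^sub>C x)"
    unfolding scaleC_of_real[symmetric] scaleC_scaleC by (simp add: mult.commute)
next
  show "norm (c *\<^sub>C x) \<le> norm x * cmod c" for x :: 'a
    by (simp add: norm_scaleC mult.commute)
qed (simp add: scaleC_add_right)

lemma bounded_linear_scaleC_comp:
  "bounded_linear T \<Longrightarrow> bounded_linear (\<lambda>x. c *\<^sub>C (T x :: 'a::cbanach))"
  by (rule bounded_linear_compose[OF bounded_linear_scaleC])

lemma bounded_linear_funpow:
  fixes T :: "'a::real_normed_vector \<Rightarrow> 'a"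
  assumes "bounded_linear T"
  shows "bounded_linear (T ^^ n)"
proof (induction n)
  case 0
  show ?case by (simp add: id_def bounded_linear_ident)
next
  case (Suc n)
  show ?case using bounded_linear_compose[OF assms Suc] by (simp add: comp_def)
qed

lemma bounded_clinear_funpow:
  assumes "bounded_clinear T"
  shows "bounded_clinear (T ^^ n)"
proof -
  have "(T ^^ n) (c *\<^sub>C x) = c *\<^sub>C (T ^^ n) x" for c x
    by (induction n) (use assms in \<open>auto simp: bounded_clinear_def\<close>)
  then show ?thesis
    using assms bounded_linear_funpow by (auto simp: bounded_clinear_def)
qed

lemma funpow_scaleC:
  assumes "bounded_clinear T"
  shows "((\<lambda>x. c *\<^sub>C T x) ^^ n) x = c ^ n *\<^sub>C (T ^^ n) x"
  by (induction n) (use assms in \<open>simp_all add: bounded_clinear_def scaleC_scaleC mult.commute\<close>)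

lemma norm_funpow_le:
  fixes T :: "'a::real_normed_vector \<Rightarrow> 'a"
  assumes "\<And>x. norm (T x) \<le> q * norm x" and "q \<ge> 0"
  shows "norm ((T ^^ n) x) \<le> q ^ n * norm x"
proof (induction n)
  case (Suc n)
  have "norm ((T ^^ Suc n) x) \<le> q * norm ((T ^^ n) x)"
    using assms(1) by simp
  also have "\<dots> \<le> q * (q ^ n * norm x)"
    using Suc assms(2) by (rule mult_left_mono)
  finally show ?case by (simp add: mult.assoc)
qed simp

text \<open>The factorization with 1 - U applied first turns a lower bound for 1 - U^n into one for
  1 - U. Its mirror image \<open>diff_funpow_eq_diff\<close>, with 1 - U applied last, does the same
  for surjectivity.\<close>

lemma diff_funpow_eq_sum:
  fixes U :: "'a::real_normed_vector \<Rightarrow> 'a"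
  assumes "bounded_linear U"
  shows "x - (U ^^ n) x = (\<Sum>j<n. (U ^^ j) (x - U x))"
proof -
  have "(\<Sum>j<n. (U ^^ j) (x - U x)) = (\<Sum>j<n. (U ^^ j) x - (U ^^ Suc j) x)"
    by (simp add: linear_diff[OF bounded_linear.linear[OF bounded_linear_funpow[OF assms]]]
        funpow_swap1)
  also have "\<dots> = x - (U ^^ n) x"
    using sum_lessThan_telescope'[of "\<lambda>j. (U ^^ j) x" n] by simp
  finally show ?thesis by simp
qed

lemma diff_funpow_eq_diff:
  fixes U :: "'a::real_normed_vector \<Rightarrow> 'a"
  assumes "bounded_linear U"
  shows "x - (U ^^ n) x = (\<Sum>j<n. (U ^^ j) x) - U (\<Sum>j<n. (U ^^ j) x)"
proof -
  have "(\<Sum>j<n. (U ^^ j) x) - U (\<Sum>j<n. (U ^^ j) x) = (\<Sum>j<n. (U ^^ j) x - (U ^^ Suc j) x)"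
    by (simp add: linear_sum[OF bounded_linear.linear[OF assms]] sum_subtractf)
  also have "\<dots> = x - (U ^^ n) x"
    using sum_lessThan_telescope'[of "\<lambda>j. (U ^^ j) x" n] by simp
  finally show ?thesis by simp
qed

section \<open>Bounded inverses and the spectrum\<close>

text \<open>For a bounded linear map this is the existence of a bounded inverse, split into
  solvability and an a priori estimate, so that no inverse has to be named.\<close>

definition bicontinuous :: "('a::real_normed_vector \<Rightarrow> 'a) \<Rightarrow> bool" where
  "bicontinuous T \<longleftrightarrow> surj T \<and> (\<exists>K. \<forall>x. norm x \<le> K * norm (T x))"

lemma bicontinuousI:
  "(\<And>y. \<exists>x. T x = y) \<Longrightarrow> (\<And>x. norm x \<le> K * norm (T x)) \<Longrightarrow> bicontinuous T"
  by (auto simp: bicontinuous_def surj_def) metis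

lemma bicontinuous_imp_surj: "bicontinuous T \<Longrightarrow> surj T"
  by (simp add: bicontinuous_def)

lemma bicontinuous_imp_pos_bound:
  assumes "bicontinuous T"
  obtains K where "K > 0" "\<And>x. norm x \<le> K * norm (T x)"
proof -
  from assms obtain K where K: "\<And>x. norm x \<le> K * norm (T x)"
    by (auto simp: bicontinuous_def)
  have "norm x \<le> max K 1 * norm (T x)" for x
    by (rule order_trans[OF K]) (intro mult_right_mono, auto)
  then show ?thesis using that[of "max K 1"] by auto
qed

lemma bicontinuous_scaleC_iff:
  fixes T :: "'a::cbanach \<Rightarrow> 'a"
  assumes "c \<noteq> 0"
  shows "bicontinuous (\<lambda>x. c *\<^sub>C T x) \<longleftrightarrow> bicontinuous T"
proof -
  have *: "bicontinuous (\<lambda>x. c *\<^sub>C T x)" if "bicontinuous T" "c \<noteq> 0" for T :: "'a \<Rightarrow> 'a" and c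
  proof -
    from that(1) obtain K where K: "\<And>x. norm x \<le> K * norm (T x)"
      unfolding bicontinuous_def by blast
    show ?thesis
    proof (rule bicontinuousI)
      fix y
      from that(1) obtain x where "T x = inverse c *\<^sub>C y"
        unfolding bicontinuous_def by (metis surjD)
      then show "\<exists>x. c *\<^sub>C T x = y" using that(2)
        by (intro exI[of _ x]) (simp add: scaleC_scaleC scaleC_one)
    next
      show "norm x \<le> K / cmod c * norm (c *\<^sub>C T x)" for x
        using K[of x] that(2) by (simp add: norm_scaleC)
    qed
  qed
  show ?thesis
    using *[of T c] *[of "\<lambda>x. c *\<^sub>C T x" "inverse c"] assms by (auto simp: scaleC_scaleC scaleC_one)
qed

text \<open>The lower bound makes z - A injective; the inverse function of this complex linear
  bijection is complex linear, and the constant of the lower bound bounds it.\<close>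

lemma not_in_op_spectrum_iff:
  assumes "bounded_clinear A"
  shows "z \<notin> op_spectrum A \<longleftrightarrow> bicontinuous (\<lambda>x. z *\<^sub>C x - A x)"
proof
  assume "z \<notin> op_spectrum A"
  then obtain B where B: "bounded_clinear B" "\<And>x. B (z *\<^sub>C x - A x) = x"
    "\<And>x. z *\<^sub>C B x - A (B x) = x"
    by (auto simp: op_spectrum_def)
  from B(1) have "bounded_linear B" by (simp add: bounded_clinear_def)
  then obtain K where "\<And>x. norm (B x) \<le> norm x * K"
    using bounded_linear.bounded by blast
  then have "norm x \<le> K * norm (z *\<^sub>C x - A x)" for x
    using B(2) by (metis mult.commute)
  then show "bicontinuous (\<lambda>x. z *\<^sub>C x - A x)"
    using B(3) by (intro bicontinuousI) auto
next
  let ?T = "\<lambda>x. z *\<^sub>C x - A x"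
  assume bi: "bicontinuous ?T"
  then obtain K where K: "\<And>x. norm x \<le> K * norm (?T x)"
    by (rule bicontinuous_imp_pos_bound) blast
  have A: "bounded_linear A" "\<And>c x. A (c *\<^sub>C x) = c *\<^sub>C A x"
    using assms by (auto simp: bounded_clinear_def)
  note add = linear_add[OF bounded_linear.linear[OF A(1)]]
  note diff = linear_diff[OF bounded_linear.linear[OF A(1)]]
  have inj: "x = y" if "?T x = ?T y" for x y
  proof -
    have "?T (x - y) = ?T x - ?T y" by (simp add: diff scaleC.scale_right_diff_distrib)
    then show ?thesis using K[of "x - y"] that by simp
  qed
  define B where "B = inv_into UNIV ?T"
  have TB: "?T (B y) = y" for y
    using surj_f_inv_f[of ?T y] bi by (simp only: B_def bicontinuous_def)
  have BT: "B (?T x) = x" for x using inj[OF TB[of "?T x"]] .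
  have B_scale: "B (c *\<^sub>C y) = c *\<^sub>C B y" for c y
  proof (rule inj)
    have "?T (c *\<^sub>C B y) = c *\<^sub>C ?T (B y)"
      by (simp add: A(2) scaleC.scale_right_diff_distrib mult.commute)
    then show "?T (B (c *\<^sub>C y)) = ?T (c *\<^sub>C B y)" by (simp only: TB)
  qed
  have B_add: "B (x + y) = B x + B y" for x y
  proof (rule inj)
    have "?T (B x + B y) = ?T (B x) + ?T (B y)" by (simp add: add scaleC_add_right)
    then show "?T (B (x + y)) = ?T (B x + B y)" by (simp add: TB)
  qed
  have "bounded_linear B"
  proof (rule bounded_linear_intro)
    show "norm (B y) \<le> norm y * K" for y
      using K[of "B y"] TB[of y] by (simp add: mult.commute)
  qed (simp_all add: B_add B_scale flip: scaleC_of_real)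
  then have "bounded_clinear B" by (simp add: bounded_clinear_def B_scale)
  then show "z \<notin> op_spectrum A" using TB BT by (auto simp: op_spectrum_def)
qed

section \<open>Neumann series and uniform resolvent bounds\<close>

lemma bicontinuous_diff_contraction:
  fixes S :: "'a::banach \<Rightarrow> 'a"
  assumes "bounded_linear S" and S: "\<And>x. norm (S x) \<le> q * norm x" and "0 \<le> q" "q < 1"
  shows "bicontinuous (\<lambda>x. x - S x)"
proof (rule bicontinuousI)
  fix y
  \<comment> \<open>The fixed point of this contraction is the sum of the Neumann series applied to
    y.\<close>
  have "\<exists>!x. y + S x = x"
  proof (rule banach_fix_type[OF assms(3,4)])
    show "\<forall>u v. dist (y + S u) (y + S v) \<le> q * dist u v"
      using S by (simp add: dist_norm flip: linear_diff[OF bounded_linear.linear[OF assms(1)]])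
  qed
  then show "\<exists>x. x - S x = y" by (metis add_diff_cancel_right')
next
  fix x
  have "norm x \<le> norm (x - S x) + norm (S x)" using norm_triangle_ineq[of "x - S x" "S x"] by simp
  then have "(1 - q) * norm x \<le> norm (x - S x)" using S[of x] by (simp add: algebra_simps)
  then show "norm x \<le> 1 / (1 - q) * norm (x - S x)"
    using assms(4) by (simp add: field_simps)
qed

text \<open>Since 1 - U^n is the product of 1 - U and the bounded sum of the powers U^j, in either
  order, both halves of invertibility pass from 1 - U^n to 1 - U.\<close>

lemma bicontinuous_diff_power_contraction:
  fixes U :: "'a::banach \<Rightarrow> 'a"
  assumes U: "bounded_linear U" and q: "\<And>x. norm ((U ^^ n) x) \<le> q * norm x" "0 \<le> q" "q < 1"
  shows "bicontinuous (\<lambda>x. x - U x)"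
proof -
  have bi: "bicontinuous (\<lambda>x. x - (U ^^ n) x)"
    by (rule bicontinuous_diff_contraction[OF bounded_linear_funpow[OF U] q])
  then obtain K where K: "K > 0" "\<And>x. norm x \<le> K * norm (x - (U ^^ n) x)"
    by (rule bicontinuous_imp_pos_bound) blast
  have "bounded_linear (\<lambda>x. \<Sum>j<n. (U ^^ j) x)"
    by (intro bounded_linear_sum bounded_linear_funpow U)
  then obtain C where C: "\<And>x. norm (\<Sum>j<n. (U ^^ j) x) \<le> norm x * C"
    using bounded_linear.bounded by blast
  show ?thesis
  proof (rule bicontinuousI)
    fix y
    obtain x where "x - (U ^^ n) x = y"
      using bi unfolding bicontinuous_def surj_def by metis
    then show "\<exists>x. x - U x = y"
      using diff_funpow_eq_diff[OF U, of x n] by metis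
  next
    fix x
    have "norm x \<le> K * norm (\<Sum>j<n. (U ^^ j) (x - U x))"
      using K(2)[of x] by (simp only: diff_funpow_eq_sum[OF U])
    also have "\<dots> \<le> K * (norm (x - U x) * C)"
      using C K(1) by (intro mult_left_mono) auto
    finally show "norm x \<le> (K * C) * norm (x - U x)" by (simp add: mult_ac)
  qed
qed

text \<open>With c = 1/z the region |z| >= 1 becomes the closed unit disk without 0; adding c = 0,
  where 1 - cT is the identity, makes it compact.\<close>

lemma not_in_op_spectrum_iff_inverse:
  fixes T :: "'a::cbanach \<Rightarrow> 'a"
  assumes "bounded_clinear T" and "z \<noteq> 0"
  shows "z \<notin> op_spectrum T \<longleftrightarrow> bicontinuous (\<lambda>x. x - inverse z *\<^sub>C T x)"
proof -
  have "(\<lambda>x. z *\<^sub>C x - T x) = (\<lambda>x. z *\<^sub>C (x - inverse z *\<^sub>C T x))"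
    using assms(2) by (simp add: scaleC.scale_right_diff_distrib scaleC_scaleC scaleC_one)
  then show ?thesis
    using not_in_op_spectrum_iff[OF assms(1), of z] bicontinuous_scaleC_iff[OF assms(2)] by metis
qed

lemma op_spectrum_subset_of_power_contraction:
  fixes T :: "'a::cbanach \<Rightarrow> 'a"
  assumes T: "bounded_clinear T" and q: "\<And>x. norm ((T ^^ n) x) \<le> q * norm x" "0 \<le> q" "q < 1"
  shows "op_spectrum T \<subseteq> {z. cmod z < 1}"
proof (rule subsetI, rule ccontr)
  fix z assume z: "z \<in> op_spectrum T" "z \<notin> {z. cmod z < 1}"
  then have [simp]: "z \<noteq> 0" by auto
  have "bounded_linear T" using T by (simp add: bounded_clinear_def)
  then have "bicontinuous (\<lambda>x. x - inverse z *\<^sub>C T x)"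
  proof (rule bicontinuous_diff_power_contraction[OF bounded_linear_scaleC_comp _ q(2,3)])
    fix x
    have "norm (((\<lambda>x. inverse z *\<^sub>C T x) ^^ n) x) = inverse (cmod z) ^ n * norm ((T ^^ n) x)"
      by (simp add: funpow_scaleC[OF T] norm_scaleC norm_power norm_inverse)
    also have "\<dots> \<le> 1 * norm ((T ^^ n) x)"
      using z(2) by (intro mult_right_mono power_le_one) (auto simp: inverse_le_1_iff)
    also have "\<dots> \<le> q * norm x" using q(1) by simp
    finally show "norm (((\<lambda>x. inverse z *\<^sub>C T x) ^^ n) x) \<le> q * norm x" .
  qed
  then show False using z(1) not_in_op_spectrum_iff_inverse[OF T, of z] by simp
qed

text \<open>
  By the resolvent identity a bound at one point extends with twice the constant to a
  neighbourhood, and the disk is compact.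
\<close>

lemma uniform_bound_on_disk:
  fixes T :: "'a::cbanach \<Rightarrow> 'a"
  assumes T: "bounded_clinear T"
    and bi: "\<And>c. cmod c \<le> 1 \<Longrightarrow> bicontinuous (\<lambda>x. x - c *\<^sub>C T x)"
  obtains K where "K > 0" "\<And>c x. cmod c \<le> 1 \<Longrightarrow> norm x \<le> K * norm (x - c *\<^sub>C T x)"
proof -
  obtain B where B: "B > 0" "\<And>x. norm (T x) \<le> norm x * B"
    using T bounded_linear.pos_bounded unfolding bounded_clinear_def by blast
  have "\<exists>K>0. \<forall>x. norm x \<le> K * norm (x - c *\<^sub>C T x)" if "c \<in> cball 0 1" for c
    using bicontinuous_imp_pos_bound[OF bi[of c]] that by (auto simp: dist_norm)
  then obtain k where k: "\<And>c. c \<in> cball 0 1 \<Longrightarrow> k c > 0"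
    "\<And>c x. c \<in> cball 0 1 \<Longrightarrow> norm x \<le> k c * norm (x - c *\<^sub>C T x)"
    by metis
  \<comment> \<open>With this radius the perturbation term k c * r c * B * norm x equals half of
    norm x and can be absorbed on the left.\<close>
  define r where "r c = 1 / (2 * B * k c)" for c
  have loc: "norm x \<le> 2 * k c * norm (x - d *\<^sub>C T x)"
    if c: "c \<in> cball 0 1" and d: "d \<in> ball c (r c)" for c d x
  proof -
    have "x - c *\<^sub>C T x = (x - d *\<^sub>C T x) + (d - c) *\<^sub>C T x"
      by (simp add: scaleC.scale_left_diff_distrib)
    then have "norm (x - c *\<^sub>C T x) \<le> norm (x - d *\<^sub>C T x) + cmod (d - c) * norm (T x)"
      by (metis norm_scaleC norm_triangle_ineq)
    also have "\<dots> \<le> norm (x - d *\<^sub>C T x) + r c * (norm x * B)"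
      using d B k(1)[OF c] by (intro add_left_mono mult_mono) (auto simp: dist_norm norm_minus_commute r_def)
    finally have "norm x \<le> k c * (norm (x - d *\<^sub>C T x) + r c * (norm x * B))"
      using k(2)[OF c, of x] k(1)[OF c] by (meson mult_left_mono less_imp_le order_trans)
    also have "\<dots> = k c * norm (x - d *\<^sub>C T x) + norm x / 2"
      using B(1) k(1)[OF c] by (simp add: r_def field_simps)
    finally show ?thesis by simp
  qed
  have "cball 0 1 \<subseteq> (\<Union>c\<in>cball 0 1. ball c (r c))"
    using k(1) B(1) by (force simp: r_def)
  then obtain D where D: "D \<subseteq> cball 0 1" "finite D" "cball 0 1 \<subseteq> (\<Union>c\<in>D. ball c (r c))"
    using compactE_image[OF compact_cball[of "0::complex" 1], of "cball 0 1" "\<lambda>c. ball c (r c)"]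
    by auto
  have k_nonneg: "0 \<le> k c" if "c \<in> D" for c
    using k(1)[of c] that D(1) by (meson less_imp_le subsetD)
  show ?thesis
  proof
    \<comment> \<open>The sum dominates each local constant of the finite cover; the summand 1 makes
      it positive.\<close>
    show "1 + (\<Sum>c\<in>D. 2 * k c) > 0"
      using k_nonneg by (intro add_pos_nonneg sum_nonneg) auto
  next
    fix d x assume "cmod d \<le> 1"
    then obtain c where c: "c \<in> D" "d \<in> ball c (r c)" using D(3) by fastforce
    have "2 * k c \<le> (\<Sum>c\<in>D. 2 * k c)"
      using c D k_nonneg by (intro member_le_sum) auto
    then have "2 * k c \<le> 1 + (\<Sum>c\<in>D. 2 * k c)" by simp
    then show "norm x \<le> (1 + (\<Sum>c\<in>D. 2 * k c)) * norm (x - d *\<^sub>C T x)"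
      using loc[of c d x] c D(1) by (meson mult_right_mono norm_ge_zero order_trans subsetD)
  qed
qed

section \<open>Averages over roots of unity\<close>

lemma root_unity_power:
  assumes "0 < n"
  shows "(cis (2 * pi / n) ^ k) ^ n = 1"
proof -
  have "(cis (2 * pi / n) ^ k) ^ n = (cis (2 * pi / n) ^ n) ^ k"
    by (simp only: power_mult[symmetric] mult.commute[of k n])
  moreover have "cis (2 * pi / n) ^ n = 1" using assms by (simp add: Complex.DeMoivre)
  ultimately show ?thesis by simp
qed

text \<open>For 0 < j < n this is a geometric sum whose ratio is an n-th root of unity other than 1,
  because n does not divide j.\<close>

lemma sum_roots_unity_powers:
  assumes "0 < n" "j < n"
  shows "(\<Sum>k<n. (cis (2 * pi / n) ^ k) ^ j) = (if j = 0 then of_nat n else 0)"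
proof (cases "j = 0")
  case False
  let ?w = "cis (2 * pi / n) ^ j"
  have n: "?w ^ n = 1"
    by (rule root_unity_power[OF assms(1)])
  have "?w \<noteq> 1"
  proof
    assume "?w = 1"
    moreover have "?w = exp (2 * of_real pi * \<i> * of_nat j / of_nat n)"
      by (simp add: cis_conv_exp mult_ac flip: exp_of_nat_mult)
    ultimately have "n dvd j"
      using complex_root_unity_eq_1[of n j] assms by simp
    then show False using False assms by (simp add: nat_dvd_not_less)
  qed
  then have "(\<Sum>k<n. ?w ^ k) = 0"
    using n by (simp add: geometric_sum)
  then show ?thesis using False by (simp add: mult.commute flip: power_mult)
qed simp

text \<open>After the sums are swapped, orthogonality of the roots of unity leaves only the term j =
  0.\<close>

lemma sum_roots_unity_powers_funpow:
  assumes n: "0 < n"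
  shows "(\<Sum>k<n. \<Sum>j<n. (of_real r * cis (2 * pi / n) ^ k) ^ j *\<^sub>C (T ^^ j) y)
    = real n *\<^sub>R (y :: 'a::cbanach)"
proof -
  have "(\<Sum>k<n. \<Sum>j<n. (of_real r * cis (2 * pi / n) ^ k) ^ j *\<^sub>C (T ^^ j) y) =
    (\<Sum>j<n. (of_real r ^ j * (\<Sum>k<n. (cis (2 * pi / n) ^ k) ^ j)) *\<^sub>C (T ^^ j) y)"
    by (subst sum.swap) (simp add: power_mult_distrib sum_distrib_left scaleC.scale_sum_left)
  also have "\<dots> = (\<Sum>j<n. if j = 0 then of_nat n *\<^sub>C y else 0)"
    using n by (intro sum.cong) (auto simp: sum_roots_unity_powers)
  also have "\<dots> = of_nat n *\<^sub>C y" using n by (simp add: sum.delta')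
  finally show ?thesis by (simp flip: scaleC_of_real)
qed

text \<open>
  With \<open>\<omega>\<close> a primitive \<open>n\<close>-th root of unity, the average over \<open>k < n\<close> of the resolvents
  \<open>(1 - r \<omega>\<^sup>k T)\<^sup>-\<^sup>1\<close> is \<open>(1 - r\<^sup>n T\<^sup>n)\<^sup>-\<^sup>1\<close>.
\<close>

lemma root_unity_resolvent_average:
  fixes T :: "'a::cbanach \<Rightarrow> 'a"
  assumes T: "bounded_clinear T" and n: "0 < n"
    and b: "\<And>k. k < n \<Longrightarrow> b k - (of_real r * cis (2 * pi / n) ^ k) *\<^sub>C T (b k) = y"
  defines "w \<equiv> (1 / real n) *\<^sub>R (\<Sum>k<n. b k)"
  shows "w - r ^ n *\<^sub>R (T ^^ n) w = y"
proof -
  let ?c = "\<lambda>k. of_real r * cis (2 * pi / n) ^ k"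
  have lin: "bounded_linear T" using T by (simp add: bounded_clinear_def)
  \<comment> \<open>All n scalars have the same n-th power, so the n factorizations concern one
    operator 1 - r^n T^n.\<close>
  have "?c k ^ n = of_real (r ^ n)" for k
    by (simp add: power_mult_distrib root_unity_power[OF n])
  then have "b k - r ^ n *\<^sub>R (T ^^ n) (b k) = (\<Sum>j<n. ?c k ^ j *\<^sub>C (T ^^ j) y)" if "k < n" for k
    using diff_funpow_eq_sum[OF bounded_linear_scaleC_comp[OF lin, of "?c k"], of "b k" n] b[OF that]
    by (simp only: funpow_scaleC[OF T] scaleC_of_real)
  then have "(\<Sum>k<n. b k - r ^ n *\<^sub>R (T ^^ n) (b k)) = real n *\<^sub>R y"
    using sum_roots_unity_powers_funpow[OF n, of r T y] by simp
  moreover have "(\<Sum>k<n. b k - r ^ n *\<^sub>R (T ^^ n) (b k)) =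
      (\<Sum>k<n. b k) - r ^ n *\<^sub>R (T ^^ n) (\<Sum>k<n. b k)"
    by (simp add: sum_subtractf scaleR_sum_right
        linear_sum[OF bounded_linear.linear[OF bounded_linear_funpow[OF lin]]])
  ultimately have "real n *\<^sub>R (w - r ^ n *\<^sub>R (T ^^ n) w) = real n *\<^sub>R y"
    using n by (simp add: w_def scaleR_right_diff_distrib scaleR_left_commute[of "real n"]
        linear_cmul[OF bounded_linear.linear[OF bounded_linear_funpow[OF lin]]])
  then show ?thesis using n by (simp only: scaleR_cancel_left) simp
qed

text \<open>The other order of composition: averaging resolvents applied to (1 - r^n T^n) x returns
  x. It recovers x before 1 - r^n T^n is known to be invertible.\<close>

lemma root_unity_resolvent_average_of_diff:
  fixes T :: "'a::cbanach \<Rightarrow> 'a"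
  assumes T: "bounded_clinear T" and n: "0 < n"
    and inj: "\<And>k u. k < n \<Longrightarrow> u - (of_real r * cis (2 * pi / n) ^ k) *\<^sub>C T u = 0 \<Longrightarrow> u = 0"
    and a: "\<And>k. k < n \<Longrightarrow> a k - (of_real r * cis (2 * pi / n) ^ k) *\<^sub>C T (a k)
      = x - r ^ n *\<^sub>R (T ^^ n) x"
  shows "(1 / real n) *\<^sub>R (\<Sum>k<n. a k) = x"
proof -
  let ?c = "\<lambda>k. of_real r * cis (2 * pi / n) ^ k"
  have lin: "bounded_linear T" using T by (simp add: bounded_clinear_def)
  have c: "?c k ^ n = of_real (r ^ n)" for k
    by (simp add: power_mult_distrib root_unity_power[OF n])
  \<comment> \<open>Applying 1 - cT to this geometric sum also gives (1 - c^n T^n) x, so injectivity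
    identifies it with \<open>a k\<close>.\<close>
  have "a k = (\<Sum>j<n. ?c k ^ j *\<^sub>C (T ^^ j) x)" if k: "k < n" for k
  proof -
    let ?s = "\<Sum>j<n. ?c k ^ j *\<^sub>C (T ^^ j) x"
    have "?s - ?c k *\<^sub>C T ?s = x - r ^ n *\<^sub>R (T ^^ n) x"
      using diff_funpow_eq_diff[OF bounded_linear_scaleC_comp[OF lin, of "?c k"], of x n]
      by (simp only: funpow_scaleC[OF T] scaleC_of_real c)
    moreover have "(a k - ?s) - ?c k *\<^sub>C T (a k - ?s) =
        (a k - ?c k *\<^sub>C T (a k)) - (?s - ?c k *\<^sub>C T ?s)"
      by (simp only: linear_diff[OF bounded_linear.linear[OF lin]] scaleC.scale_right_diff_distrib)
        (simp add: algebra_simps)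
    ultimately have "(a k - ?s) - ?c k *\<^sub>C T (a k - ?s) = 0"
      by (simp only: a[OF k]) simp
    then show ?thesis using inj[OF k, of "a k - ?s"] by simp
  qed
  then have "(\<Sum>k<n. a k) = real n *\<^sub>R x"
    using sum_roots_unity_powers_funpow[OF n, of r T x] by simp
  then show ?thesis using n by simp
qed

section \<open>From radius s to radius t\<close>

text \<open>For y = x - t^p T^p x, averaging resolvents of y at radius t gives x, and at radius s
  gives w with w - s^p T^p w = y. Smallness of s^p T^p puts w near y, and the Lipschitz bound on
  resolvents puts x near w; hence t^p T^p x = x - y is small.\<close>

lemma power_contraction_step:
  fixes T :: "'a::cbanach \<Rightarrow> 'a"
  assumes T: "bounded_clinear T"
    and bi: "\<And>c. cmod c \<le> 1 \<Longrightarrow> bicontinuous (\<lambda>x. x - c *\<^sub>C T x)"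
    and K: "K > 0" "\<And>c x. cmod c \<le> 1 \<Longrightarrow> norm x \<le> K * norm (x - c *\<^sub>C T x)"
    and B: "B > 0" "\<And>x. norm (T x) \<le> B * norm x"
    and s: "0 \<le> s" "s \<le> t" "t \<le> 1" and st: "(t - s) * (K * B * K) \<le> 1 / 8"
    and n: "0 < n" "\<And>x. norm (s ^ n *\<^sub>R (T ^^ n) x) \<le> 1 / 3 * norm x"
  shows "\<exists>n>0. \<forall>x. norm (t ^ n *\<^sub>R (T ^^ n) x) \<le> 1 / 3 * norm x"
proof -
  have lin: "bounded_linear T" using T by (simp add: bounded_clinear_def)
  \<comment> \<open>Raising the exponent from n to l * n gains the factor 1/(8K), which cancels K in
    the bound on w below. The minimum with 1 excludes l = 0.\<close>
  obtain l where l: "(1 / 3 :: real) ^ l < min 1 (1 / (8 * K))"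
    using real_arch_pow_inv[of "min 1 (1 / (8 * K))" "1 / 3"] K(1) by auto
  then have "l > 0" by (cases l) auto
  define p where "p = l * n"
  have p: "p > 0" using \<open>l > 0\<close> n(1) by (simp add: p_def)
  have small: "norm (s ^ p *\<^sub>R (T ^^ p) x) \<le> 1 / (8 * K) * norm x" for x
  proof -
    let ?U = "\<lambda>x. s ^ n *\<^sub>R (T ^^ n) x"
    have "(?U ^^ l) x = s ^ p *\<^sub>R (T ^^ p) x"
    proof -
      have "?U = (\<lambda>x. of_real (s ^ n) *\<^sub>C (T ^^ n) x)" by (simp only: scaleC_of_real)
      then have "(?U ^^ l) x = of_real (s ^ n) ^ l *\<^sub>C ((T ^^ n) ^^ l) x"
        by (simp only: funpow_scaleC[OF bounded_clinear_funpow[OF T]])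
      also have "\<dots> = s ^ p *\<^sub>R (T ^^ p) x"
        by (simp add: p_def funpow_mult mult.commute[of n l] power_mult[symmetric]
            flip: scaleC_of_real)
      finally show ?thesis .
    qed
    then have "norm (s ^ p *\<^sub>R (T ^^ p) x) \<le> (1 / 3) ^ l * norm x"
      using norm_funpow_le[of ?U "1 / 3" l x] n(2) by simp
    also have "\<dots> \<le> 1 / (8 * K) * norm x"
      using l by (intro mult_right_mono) auto
    finally show ?thesis .
  qed
  let ?z = "\<lambda>k. cis (2 * pi / p) ^ k"
  have sc: "cmod (of_real s * ?z k) \<le> 1" for k using s by (simp add: norm_mult norm_power)
  have tc: "cmod (of_real t * ?z k) \<le> 1" for k using s by (simp add: norm_mult norm_power)
  have "norm (t ^ p *\<^sub>R (T ^^ p) x) \<le> 1 / 3 * norm x" for x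
  proof -
    define y where "y = x - t ^ p *\<^sub>R (T ^^ p) x"
    obtain a where a: "\<And>k. a k - (of_real t * ?z k) *\<^sub>C T (a k) = y"
      using surjD[OF bicontinuous_imp_surj[OF bi[OF tc]], of y] by metis
    obtain b where b: "\<And>k. b k - (of_real s * ?z k) *\<^sub>C T (b k) = y"
      using surjD[OF bicontinuous_imp_surj[OF bi[OF sc]], of y] by metis
    define w where "w = (1 / real p) *\<^sub>R (\<Sum>k<p. b k)"
    have x: "x = (1 / real p) *\<^sub>R (\<Sum>k<p. a k)"
    proof (rule root_unity_resolvent_average_of_diff[OF T p, symmetric])
      show "u = 0" if "u - (of_real t * ?z k) *\<^sub>C T u = 0" for u k
        using K(2)[OF tc, of u k] that by simp
      show "a k - (of_real t * ?z k) *\<^sub>C T (a k) = x - t ^ p *\<^sub>R (T ^^ p) x" for k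
        using a by (simp only: y_def)
    qed
    have w: "w - s ^ p *\<^sub>R (T ^^ p) w = y"
      unfolding w_def by (rule root_unity_resolvent_average[OF T p]) (rule b)
    have b_le: "norm (b k) \<le> K * norm y" for k
      using K(2)[OF sc, of "b k" k] b[of k] by simp
    have average_le: "norm ((1 / real p) *\<^sub>R (\<Sum>k<p. f k)) \<le> e" if "\<And>k. norm (f k) \<le> e" for f :: "nat \<Rightarrow> 'a" and e
    proof -
      have "norm (\<Sum>k<p. f k) \<le> (\<Sum>k<p. e)" using that by (intro sum_norm_le)
      then show ?thesis using p by (simp add: field_simps)
    qed
    have "norm w \<le> K * norm y" unfolding w_def by (rule average_le[OF b_le])
    then have "1 / (8 * K) * norm w \<le> 1 / 8 * norm y" using K(1) by (simp add: field_simps)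
    moreover have "w - y = s ^ p *\<^sub>R (T ^^ p) w" using w by (simp add: algebra_simps)
    ultimately have wy: "norm (w - y) \<le> 1 / 8 * norm y" using small[of w] by simp
    have ab: "norm (a k - b k) \<le> 1 / 8 * norm y" for k
    proof -
      \<comment> \<open>Resolvent identity: \<open>a k - b k\<close> is the resolvent at radius t
        applied to (t - s) times the root of unity times \<open>T (b k)\<close>.\<close>
      have "(a k - b k) - (of_real t * ?z k) *\<^sub>C T (a k - b k) =
          y - (b k - (of_real t * ?z k) *\<^sub>C T (b k))"
        using a[of k] by (simp add: linear_diff[OF bounded_linear.linear[OF lin]]
            scaleC.scale_right_diff_distrib algebra_simps)
      also have "\<dots> = (of_real (t - s) * ?z k) *\<^sub>C T (b k)"
        using b[of k] by (simp add: algebra_simps scaleC.scale_left_diff_distrib)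
      finally have "norm (a k - b k) \<le> K * norm ((of_real (t - s) * ?z k) *\<^sub>C T (b k))"
        using K(2)[OF tc, of "a k - b k" k] by simp
      also have "\<dots> = K * ((t - s) * norm (T (b k)))"
        using s by (simp only: norm_scaleC norm_mult norm_power norm_cis norm_of_real) simp
      also have "\<dots> \<le> K * ((t - s) * (B * (K * norm y)))"
        using s K(1) B(1) by (intro mult_left_mono order_trans[OF B(2)] b_le) auto
      also have "\<dots> = ((t - s) * (K * B * K)) * norm y" by (simp add: mult_ac)
      also have "\<dots> \<le> 1 / 8 * norm y" using st by (rule mult_right_mono) simp
      finally show ?thesis .
    qed
    have "x - w = (1 / real p) *\<^sub>R (\<Sum>k<p. a k - b k)"
      by (simp add: x w_def sum_subtractf scaleR_right_diff_distrib)
    then have "norm (x - w) \<le> 1 / 8 * norm y" using average_le[OF ab] by simp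
    then have xy: "norm (x - y) \<le> 1 / 4 * norm y"
      using wy norm_triangle_ineq[of "x - w" "w - y"] by simp
    \<comment> \<open>With norm (x - y) at most norm y / 4 this gives norm y <= 4/3 norm x, hence
      the constant 1/3 again.\<close>
    have "norm y \<le> norm x + norm (x - y)"
      using norm_triangle_ineq4[of x "x - y"] by simp
    moreover have "x - y = t ^ p *\<^sub>R (T ^^ p) x" by (simp add: y_def)
    ultimately show ?thesis using xy by simp
  qed
  then show ?thesis using p by blast
qed

lemma power_contraction_of_op_spectrum_subset:
  fixes T :: "'a::cbanach \<Rightarrow> 'a"
  assumes T: "bounded_clinear T" and sub: "op_spectrum T \<subseteq> {z. cmod z < 1}"
  shows "\<exists>n>0. \<forall>x. norm ((T ^^ n) x) \<le> 1 / 3 * norm x"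
proof -
  have bi: "bicontinuous (\<lambda>x. x - c *\<^sub>C T x)" if "cmod c \<le> 1" for c
  proof (cases "c = 0")
    case True
    then show ?thesis by (auto simp: bicontinuous_def surj_def intro: exI[of _ 1])
  next
    case False
    then have "1 \<le> cmod (inverse c)" using that by (simp add: norm_inverse one_le_inverse_iff)
    then have "inverse c \<notin> op_spectrum T" using sub by auto
    then show ?thesis using not_in_op_spectrum_iff_inverse[OF T, of "inverse c"] False by simp
  qed
  obtain K where K: "K > 0" "\<And>c x. cmod c \<le> 1 \<Longrightarrow> norm x \<le> K * norm (x - c *\<^sub>C T x)"
    using uniform_bound_on_disk[OF T bi] by blast
  obtain B where "B > 0" "\<And>x. norm (T x) \<le> norm x * B"
    using T bounded_linear.pos_bounded unfolding bounded_clinear_def by blast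
  then have B: "B > 0" "\<And>x. norm (T x) \<le> B * norm x" by (simp_all add: mult.commute)
  \<comment> \<open>The mesh 1/q meets the step condition with constants valid on the whole disk.
    The induction starts at radius 0, where the first power already vanishes.\<close>
  obtain q :: nat where q: "8 * (K * B * K) < real q" using reals_Archimedean2 by blast
  moreover have "0 < K * B * K" using K(1) B(1) by simp
  ultimately have "real q > 0" by linarith
  then have "q > 0" by simp
  define P where "P t \<longleftrightarrow> (\<exists>n>0. \<forall>x. norm (t ^ n *\<^sub>R (T ^^ n) x) \<le> 1 / 3 * norm x)" for t
  have "P (real i / real q)" if "i \<le> q" for i
    using that
  proof (induction i)
    case 0
    show ?case by (auto simp: P_def intro: exI[of _ 1])
  next
    case (Suc i)
    then obtain n where n: "n > 0"
      "\<And>x. norm ((real i / real q) ^ n *\<^sub>R (T ^^ n) x) \<le> 1 / 3 * norm x"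
      by (auto simp: P_def)
    have "(real (Suc i) / real q - real i / real q) * (K * B * K) \<le> 1 / 8"
      using q \<open>q > 0\<close> by (simp add: field_simps)
    then show ?case
      unfolding P_def using Suc.prems \<open>q > 0\<close>
      by (intro power_contraction_step[OF T bi K B _ _ _ _ n]) (auto simp: divide_right_mono)
  qed
  from this[of q] show ?thesis using \<open>q > 0\<close> by (simp add: P_def)
qed

text \<open>Convergence yields one power of norm below 1. Conversely, a power p contracting by 1/3
  gives geometric decay in n div p, while the remaining n mod p factors cost a constant.\<close>

theorem onorm_funpow_tendsto_0_iff:
  fixes T :: "'a::cbanach \<Rightarrow> 'a"
  assumes T: "bounded_clinear T"
  shows "(\<lambda>n. onorm (T ^^ n)) \<longlonglongrightarrow> 0 \<longleftrightarrow> op_spectrum T \<subseteq> {z. cmod z < 1}"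
proof
  have lin: "bounded_linear T" using T by (simp add: bounded_clinear_def)
  note lin_pow = bounded_linear_funpow[OF lin]
  assume "(\<lambda>n. onorm (T ^^ n)) \<longlonglongrightarrow> 0"
  then have "\<forall>\<^sub>F n in sequentially. onorm (T ^^ n) < 1"
    by (rule order_tendstoD) simp
  then obtain n where "onorm (T ^^ n) < 1"
    by (auto simp: eventually_sequentially)
  then show "op_spectrum T \<subseteq> {z. cmod z < 1}"
    using onorm[OF lin_pow] onorm_pos_le[OF lin_pow]
    by (intro op_spectrum_subset_of_power_contraction[OF T, of n "onorm (T ^^ n)"])
next
  have lin: "bounded_linear T" using T by (simp add: bounded_clinear_def)
  note lin_pow = bounded_linear_funpow[OF lin]
  assume "op_spectrum T \<subseteq> {z. cmod z < 1}"
  then obtain p where p: "p > 0" "\<And>x. norm ((T ^^ p) x) \<le> 1 / 3 * norm x"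
    using power_contraction_of_op_spectrum_subset[OF T] by blast
  define C where "C = (\<Sum>j<p. onorm (T ^^ j))"
  have C: "onorm (T ^^ j) \<le> C" if "j < p" for j
    unfolding C_def using that by (intro member_le_sum onorm_pos_le lin_pow) auto
  have C0: "C \<ge> 0" unfolding C_def by (intro sum_nonneg onorm_pos_le lin_pow)
  have bound: "onorm (T ^^ n) \<le> C * (1 / 3) ^ (n div p)" for n
  proof (rule onorm_bound)
    fix x
    have "(T ^^ n) x = (T ^^ (n mod p)) (((T ^^ p) ^^ (n div p)) x)"
      by (metis comp_apply funpow_add funpow_mult mod_mult_div_eq)
    then have "norm ((T ^^ n) x) \<le> onorm (T ^^ (n mod p)) * norm (((T ^^ p) ^^ (n div p)) x)"
      using onorm[OF lin_pow] by simp
    also have "\<dots> \<le> C * ((1 / 3) ^ (n div p) * norm x)"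
      using p C0 by (intro mult_mono C norm_funpow_le) auto
    finally show "norm ((T ^^ n) x) \<le> C * (1 / 3) ^ (n div p) * norm x" by (simp add: mult.assoc)
  qed (use C0 in simp)
  have "filterlim (\<lambda>n. n div p) at_top sequentially"
    unfolding filterlim_at_top
  proof
    fix Z :: nat
    show "\<forall>\<^sub>F n in sequentially. Z \<le> n div p"
      using eventually_ge_at_top[of "Z * p"]
      by eventually_elim (simp add: less_eq_div_iff_mult_less_eq[OF p(1)])
  qed
  then have "(\<lambda>n. (1 / 3 :: real) ^ (n div p)) \<longlonglongrightarrow> 0"
    by (rule filterlim_compose[OF LIMSEQ_power_zero, rotated]) simp
  then have "(\<lambda>n. C * (1 / 3) ^ (n div p)) \<longlonglongrightarrow> 0"
    by (rule tendsto_mult_right_zero)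
  then show "(\<lambda>n. onorm (T ^^ n)) \<longlonglongrightarrow> 0"
    by (rule tendsto_sandwich[OF _ _ tendsto_const, rotated 2])
      (auto intro!: always_eventually onorm_pos_le lin_pow bound)
qed

section \<open>The operator matrix on bounded sequences\<close>

text \<open>
  The library proves completeness of \<open>\<Rightarrow>\<^sub>C\<close> only for functions on a metric space, which the
  type \<open>nat\<close> is not yet.
\<close>

instantiation nat :: metric_space
begin

definition dist_nat :: "nat \<Rightarrow> nat \<Rightarrow> real" where
  "dist_nat m n = \<bar>real m - real n\<bar>"

definition uniformity_nat :: "(nat \<times> nat) filter" where
  "uniformity_nat = (INF e\<in>{0<..}. principal {(x, y). dist x y < e})"

instance
proof
  \<comment> \<open>Naturals at distance below 1 coincide, so the metric induces the discrete
    topology of \<open>nat\<close>.\<close>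
  have eqI: "y = x" if "\<bar>real x - real y\<bar> < 1" for x y :: nat
  proof -
    have "real x < real (Suc y)" "real y < real (Suc x)" using that by auto
    then show ?thesis by (simp only: of_nat_less_iff)
  qed
  have "\<forall>\<^sub>F (x', y) in uniformity. x' = x \<longrightarrow> y \<in> U" if "x \<in> U" for x and U :: "nat set"
  proof -
    have "\<forall>\<^sub>F (x', y) in principal {(x, y). dist x y < (1 :: real)}. x' = x \<longrightarrow> y \<in> U"
      using that by (auto simp: eventually_principal dist_nat_def dest: eqI)
    then show ?thesis
      unfolding uniformity_nat_def by (rule eventually_INF1[rotated]) simp
  qed
  then show "open U \<longleftrightarrow> (\<forall>x\<in>U. \<forall>\<^sub>F (x', y) in uniformity. x' = x \<longrightarrow> y \<in> U)" for U :: "nat set"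
    by (simp add: open_discrete)
qed (auto simp: dist_nat_def uniformity_nat_def)

end

section \<open>The complex Banach space of bounded sequences\<close>

instance bcontfun :: (metric_space, banach) banach ..

instantiation bcontfun :: (metric_space, cbanach) cbanach
begin

definition scaleC_bcontfun :: "complex \<Rightarrow> ('a \<Rightarrow>\<^sub>C 'b) \<Rightarrow> 'a \<Rightarrow>\<^sub>C 'b" where
  "scaleC_bcontfun c f = Bcontfun (\<lambda>x. c *\<^sub>C apply_bcontfun f x)"

lemma apply_bcontfun_scaleC [simp]:
  "apply_bcontfun (c *\<^sub>C f) x = c *\<^sub>C apply_bcontfun f x"
proof -
  have "(\<lambda>x. c *\<^sub>C apply_bcontfun f x) \<in> bcontfun"
  proof (rule bcontfun_normI)
    show "norm (c *\<^sub>C apply_bcontfun f x) \<le> cmod c * norm f" for x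
      by (simp add: norm_scaleC mult_left_mono norm_bounded)
    show "continuous_on UNIV (\<lambda>x. c *\<^sub>C apply_bcontfun f x)"
      by (rule bounded_linear.continuous_on[OF bounded_linear_scaleC]) simp
  qed
  then show ?thesis by (simp add: scaleC_bcontfun_def Bcontfun_inverse)
qed

instance
proof
  fix c d :: complex and f g :: "'a \<Rightarrow>\<^sub>C 'b" and r :: real
  show "c *\<^sub>C (f + g) = c *\<^sub>C f + c *\<^sub>C g"
    by (rule bcontfun_eqI) (simp add: scaleC_add_right)
  show "(c + d) *\<^sub>C f = c *\<^sub>C f + d *\<^sub>C f"
    by (rule bcontfun_eqI) (simp add: scaleC_add_left)
  show assoc: "c *\<^sub>C (d *\<^sub>C f) = (c * d) *\<^sub>C f" for c d and f :: "'a \<Rightarrow>\<^sub>C 'b"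
    by (rule bcontfun_eqI) (simp add: scaleC_scaleC)
  show one: "1 *\<^sub>C f = f" for f :: "'a \<Rightarrow>\<^sub>C 'b"
    by (rule bcontfun_eqI) (simp add: scaleC_one)
  show "complex_of_real r *\<^sub>C f = r *\<^sub>R f"
    by (rule bcontfun_eqI) (simp add: scaleC_of_real)
  have le: "norm (c *\<^sub>C f) \<le> cmod c * norm f" for c and f :: "'a \<Rightarrow>\<^sub>C 'b"
    by (rule norm_bound) (simp add: norm_scaleC mult_left_mono norm_bounded)
  show "norm (c *\<^sub>C f) = cmod c * norm f"
  proof (cases "c = 0")
    case True
    then show ?thesis using le[of c f] by simp
  next
    case False
    \<comment> \<open>The reverse inequality is \<open>le\<close> for the inverse scalar.\<close>
    have "norm f \<le> norm (c *\<^sub>C f) / cmod c"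
      using le[of "inverse c" "c *\<^sub>C f"] False
      by (simp add: assoc one norm_inverse divide_inverse mult.commute)
    then have "cmod c * norm f \<le> norm (c *\<^sub>C f)"
      using False by (simp add: pos_le_divide_eq mult.commute)
    then show ?thesis using le[of c f] by (intro antisym)
  qed
qed

end

lemma finite_support_in_bcontfun:
  fixes v :: "nat \<Rightarrow> 'a::real_normed_vector"
  assumes "v \<in> prod_space m"
  shows "v \<in> bcontfun"
proof (rule bcontfun_normI)
  show "norm (v i) \<le> (\<Sum>j<m. norm (v j))" for i
  proof (cases "i < m")
    case True
    then show ?thesis by (intro member_le_sum) auto
  next
    case False
    then show ?thesis using assms by (simp add: prod_space_def sum_nonneg)
  qed
qed (simp add: continuous_on_discrete)

lemma apply_Bcontfun:
  fixes v :: "nat \<Rightarrow> 'a::real_normed_vector"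
  shows "v \<in> prod_space m \<Longrightarrow> apply_bcontfun (Bcontfun v) = v"
  by (rule Bcontfun_inverse) (rule finite_support_in_bcontfun)

lemma mars_op_in_prod_space: "mars_op m A v \<in> prod_space m"
  by (auto simp: prod_space_def mars_op_def)

text \<open>
  \<open>mars_op\<close> only reads the first \<open>m\<close> entries of a sequence and returns one supported there,
  so it acts on the Banach space of all bounded sequences, which does not depend on \<open>m\<close>.
\<close>

definition mars_seq :: "nat \<Rightarrow> ('a::cbanach \<Rightarrow> 'a) \<Rightarrow> (nat \<Rightarrow>\<^sub>C 'a) \<Rightarrow> (nat \<Rightarrow>\<^sub>C 'a)" where
  "mars_seq m A v = Bcontfun (mars_op m A (apply_bcontfun v))"

lemma apply_mars_seq: "apply_bcontfun (mars_seq m A v) = mars_op m A (apply_bcontfun v)"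
  unfolding mars_seq_def by (rule apply_Bcontfun[OF mars_op_in_prod_space])

lemma apply_mars_seq_funpow:
  "apply_bcontfun ((mars_seq m A ^^ n) v) = (mars_op m A ^^ n) (apply_bcontfun v)"
  by (induction n) (simp_all add: apply_mars_seq)

lemma bounded_clinear_mars_seq:
  assumes A: "bounded_clinear A"
  shows "bounded_clinear (mars_seq m A)"
proof -
  have lin: "bounded_linear A" and cA: "\<And>c x. A (c *\<^sub>C x) = c *\<^sub>C A x"
    using A by (auto simp: bounded_clinear_def)
  note linear = bounded_linear.linear[OF lin]
  obtain B where B: "B > 0" "\<And>x. norm (A x) \<le> norm x * B"
    using bounded_linear.pos_bounded[OF lin] by blast
  have scale: "mars_seq m A (c *\<^sub>C v) = c *\<^sub>C mars_seq m A v" for c v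
    by (rule bcontfun_eqI)
      (simp add: apply_mars_seq mars_op_def cA scaleC.scale_sum_right
        linear_cmul[OF bounded_linear.linear[OF bounded_linear_scaleC]])
  have "bounded_linear (mars_seq m A)"
  proof (rule bounded_linear_intro)
    show "mars_seq m A (u + v) = mars_seq m A u + mars_seq m A v" for u v
      by (rule bcontfun_eqI)
        (simp add: apply_mars_seq mars_op_def linear_add[OF linear] sum.distrib scaleR_right_distrib)
    show "mars_seq m A (r *\<^sub>R v) = r *\<^sub>R mars_seq m A v" for r v
      using scale[of "of_real r"] by (simp add: scaleC_of_real)
    \<comment> \<open>Shifted entries contribute at most norm v; the last row averages m terms of
      size at most B * norm v.\<close>
    show "norm (mars_seq m A v) \<le> norm v * (1 + B)" for v
    proof (rule norm_bound)
      fix i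
      let ?v = "apply_bcontfun v"
      have nv: "norm (?v j) \<le> norm v" for j by (rule norm_bounded)
      have "norm (\<Sum>j<m. A (?v j)) \<le> (\<Sum>j<m. norm v * B)"
        using B nv by (intro sum_norm_le order_trans[OF B(2)] mult_right_mono) auto
      then have "norm (mars_op m A ?v i) \<le> max (norm v) (norm v * B)"
        using nv[of "i + 1"] B(1) by (auto simp: mars_op_def field_simps le_max_iff_disj)
      also have "\<dots> \<le> norm v * (1 + B)"
        using B(1) by (simp add: algebra_simps)
      finally show "norm (apply_bcontfun (mars_seq m A v) i) \<le> norm v * (1 + B)"
        by (simp add: apply_mars_seq)
    qed
  qed
  then show ?thesis by (simp add: bounded_clinear_def scale)
qed

text \<open>
  The operator to which \<open>z - mars_op m A\<close> is reduced by eliminating the last \<open>m - 1\<close> entries.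
\<close>

definition mars_pencil :: "nat \<Rightarrow> ('a::cbanach \<Rightarrow> 'a) \<Rightarrow> complex \<Rightarrow> 'a \<Rightarrow> 'a" where
  "mars_pencil m A z x = z ^ m *\<^sub>C x - ((\<Sum>j<m. z ^ j) / of_nat m) *\<^sub>C A x"

section \<open>The pencil and the eigenvalues of the scalar matrix\<close>

lemma mars_pencil_bicontinuous_iff:
  assumes A: "bounded_clinear A" and "m \<ge> 1" "z \<noteq> 0"
  shows "bicontinuous (mars_pencil m A z) \<longleftrightarrow>
    (\<forall>a\<in>op_spectrum A. z ^ m \<noteq> a / of_nat m * (\<Sum>j<m. z ^ j))"
proof (cases "(\<Sum>j<m. z ^ j) = 0")
  case True
  \<comment> \<open>Both sides are true here: the pencil is z^m times the identity, and z^m = 0 is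
    impossible.\<close>
  have "bicontinuous (\<lambda>x :: 'a. x)"
    by (rule bicontinuousI[of _ 1]) auto
  then show ?thesis
    using True assms bicontinuous_scaleC_iff[of "z ^ m" "\<lambda>x :: 'a. x"]
    by (simp add: mars_pencil_def[abs_def])
next
  case False
  let ?s = "(\<Sum>j<m. z ^ j) / of_nat m"
  define a where "a = z ^ m / ?s"
  have s: "?s \<noteq> 0" using False assms by simp
  have "mars_pencil m A z = (\<lambda>x. ?s *\<^sub>C (a *\<^sub>C x - A x))"
    using s by (simp add: mars_pencil_def[abs_def] a_def scaleC.scale_right_diff_distrib scaleC_scaleC)
  then have "bicontinuous (mars_pencil m A z) \<longleftrightarrow> a \<notin> op_spectrum A"
    by (simp only: bicontinuous_scaleC_iff[OF s] not_in_op_spectrum_iff[OF A])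
  moreover have "z ^ m = b / of_nat m * (\<Sum>j<m. z ^ j) \<longleftrightarrow> b = a" for b
    using s False assms(2) by (auto simp: a_def field_simps)
  ultimately show ?thesis by auto
qed

text \<open>The first m - 1 rows force an eigenvector to be a multiple of (1, z, ..., z^(m-1)); the
  last row then becomes the scalar equation.\<close>

lemma spectrum_mars_mat_iff:
  assumes "m \<ge> 1"
  shows "z \<in> spectrum (mars_mat m a) \<longleftrightarrow> z ^ m = a / of_nat m * (\<Sum>j<m. z ^ j)"
proof -
  have eq: "mars_mat m a *\<^sub>v vec m v = z \<cdot>\<^sub>v vec m v \<longleftrightarrow>
      (\<forall>i<m. mars_op m ((*) a) v i = z * v i)" for v
    by (subst mars_mat_mult_vec) (auto simp: vec_eq_iff)
  have spec: "z \<in> spectrum (mars_mat m a) \<longleftrightarrow>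
      (\<exists>v. (\<exists>i<m. v i \<noteq> 0) \<and> (\<forall>i<m. mars_op m ((*) a) v i = z * v i))" (is "_ \<longleftrightarrow> ?R")
  proof
    assume "z \<in> spectrum (mars_mat m a)"
    then obtain w where w: "w \<in> carrier_vec m" "w \<noteq> 0\<^sub>v m" "mars_mat m a *\<^sub>v w = z \<cdot>\<^sub>v w"
      by (auto simp: spectrum_def eigenvalue_def eigenvector_def mars_mat_def)
    have "vec m (vec_index w) = w" using w(1) by auto
    moreover have "\<exists>i<m. vec_index w i \<noteq> 0" using w(1,2) by (auto simp: vec_eq_iff)
    ultimately show ?R using w(3) eq[of "vec_index w"] by (intro exI[of _ "vec_index w"]) simp
  next
    assume ?R
    then obtain v where v: "\<exists>i<m. v i \<noteq> 0" "\<forall>i<m. mars_op m ((*) a) v i = z * v i" by blast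
    then have "vec m v \<noteq> 0\<^sub>v m" by (auto simp: vec_eq_iff)
    then have "eigenvector (mars_mat m a) (vec m v) z"
      using v(2) eq[of v] by (simp add: eigenvector_def mars_mat_def)
    then show "z \<in> spectrum (mars_mat m a)" by (auto simp: spectrum_def eigenvalue_def)
  qed
  have last: "mars_op m ((*) a) v (m - 1) = a / of_nat m * (\<Sum>j<m. v j)" for v
    using assms by (simp add: mars_op_def scaleR_conv_of_real sum_distrib_left)
  show ?thesis
  proof
    assume "z \<in> spectrum (mars_mat m a)"
    then obtain v where v: "\<exists>i<m. v i \<noteq> 0" "\<And>i. i < m \<Longrightarrow> mars_op m ((*) a) v i = z * v i"
      unfolding spec by blast
    have v_eq: "v i = z ^ i * v 0" if "i < m" for i
      using that
    proof (induction i)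
      case (Suc i)
      then show ?case using v(2)[of i] by (simp add: mars_op_def)
    qed simp
    with v(1) have "v 0 \<noteq> 0" by auto
    have "a / of_nat m * (\<Sum>j<m. v j) = z * v (m - 1)"
      using v(2)[of "m - 1"] last assms by simp
    also have "(\<Sum>j<m. v j) = (\<Sum>j<m. z ^ j) * v 0"
      unfolding sum_distrib_right by (intro sum.cong refl v_eq) simp
    also have "v (m - 1) = z ^ (m - 1) * v 0"
      using assms by (intro v_eq) simp
    finally have "(a / of_nat m * (\<Sum>j<m. z ^ j)) * v 0 = (z * z ^ (m - 1)) * v 0"
      by (simp only: mult.assoc)
    moreover have "z * z ^ (m - 1) = z ^ m"
      using assms power_Suc[of z "m - 1"] by simp
    ultimately have "z ^ m * v 0 = (a / of_nat m * (\<Sum>j<m. z ^ j)) * v 0"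
      by (simp only:)
    then show "z ^ m = a / of_nat m * (\<Sum>j<m. z ^ j)"
      by (simp only: mult_right_cancel[OF \<open>v 0 \<noteq> 0\<close>])
  next
    assume z: "z ^ m = a / of_nat m * (\<Sum>j<m. z ^ j)"
    have "mars_op m ((*) a) (\<lambda>j. z ^ j) i = z * z ^ i" if "i < m" for i
    proof (cases "i + 1 < m")
      case False
      then have "m = Suc i" using that by simp
      then show ?thesis using last[of "\<lambda>j. z ^ j"] z by simp
    qed (simp add: mars_op_def)
    moreover have "\<exists>i<m. z ^ i \<noteq> 0" using assms by (intro exI[of _ 0]) simp
    ultimately show "z \<in> spectrum (mars_mat m a)"
      unfolding spec using assms by (intro exI[of _ "\<lambda>j. z ^ j"]) blast
  qed
qed

section \<open>Elimination in the resolvent equation\<close>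

text \<open>The first m - 1 rows leave tuples of this form, with g collecting the inhomogeneity. It
  is used with g = 0 and with the Horner sums.\<close>

lemma mars_op_last_row:
  assumes A: "bounded_clinear A" and "m \<ge> 1"
    and v: "\<And>j. j < m \<Longrightarrow> v j = z ^ j *\<^sub>C x - g j"
  shows "z *\<^sub>C v (m - 1) - mars_op m A v (m - 1) =
    mars_pencil m A z x - z *\<^sub>C g (m - 1) + (1 / real m) *\<^sub>R A (\<Sum>j<m. g j)"
proof -
  have lin: "linear A" and cA: "\<And>c x. A (c *\<^sub>C x) = c *\<^sub>C A x"
    using A by (auto simp: bounded_clinear_def bounded_linear.linear)
  have "(\<Sum>j<m. A (v j)) = (\<Sum>j<m. z ^ j) *\<^sub>C A x - A (\<Sum>j<m. g j)"
    by (simp add: v linear_diff[OF lin] linear_sum[OF lin] cA sum_subtractf scaleC.scale_sum_left)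
  moreover have "(1 / real m) *\<^sub>R (\<Sum>j<m. z ^ j) *\<^sub>C A x = ((\<Sum>j<m. z ^ j) / of_nat m) *\<^sub>C A x"
    by (simp add: scaleC_scaleC flip: scaleC_of_real)
  ultimately have "mars_op m A v (m - 1) =
      ((\<Sum>j<m. z ^ j) / of_nat m) *\<^sub>C A x - (1 / real m) *\<^sub>R A (\<Sum>j<m. g j)"
    using assms(2) by (simp add: mars_op_def scaleR_right_diff_distrib)
  moreover have "z *\<^sub>C z ^ (m - 1) *\<^sub>C x = z ^ m *\<^sub>C x"
    using assms(2) power_Suc[of z "m - 1"] by (simp add: scaleC_scaleC)
  ultimately show ?thesis
    using assms(2) v[of "m - 1"]
    by (simp add: mars_pencil_def scaleC.scale_right_diff_distrib)
qed

text \<open>The value at j is the sum of z^(j-1-i) f i over i < j: up to sign, what f contributes to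
  entry j when v (i+1) = z v i - f i is iterated.\<close>

primrec horner :: "complex \<Rightarrow> (nat \<Rightarrow> 'a::cbanach) \<Rightarrow> nat \<Rightarrow> 'a" where
  "horner z f 0 = 0"
| "horner z f (Suc j) = z *\<^sub>C horner z f j + f j"

lemma norm_horner_le:
  assumes "\<And>i. norm (f i) \<le> F"
  shows "norm (horner z f j) \<le> (\<Sum>i<j. cmod z ^ i) * F"
proof (induction j)
  case (Suc j)
  have "norm (horner z f (Suc j)) \<le> cmod z * norm (horner z f j) + norm (f j)"
    by (simp add: norm_triangle_le norm_scaleC)
  also have "\<dots> \<le> cmod z * ((\<Sum>i<j. cmod z ^ i) * F) + F"
    using Suc assms by (intro add_mono mult_left_mono) auto
  also have "\<dots> = (\<Sum>i<Suc j. cmod z ^ i) * F"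
    unfolding sum.lessThan_Suc_shift by (simp add: algebra_simps flip: sum_distrib_left)
  finally show ?case .
qed simp

text \<open>The first m - 1 rows are a recursion expressing every entry below m through
  \<open>v 0\<close>, which turns the last row into an equation for \<open>v 0\<close> alone. From
  index m on \<open>mars_op\<close> is 0, so those rows decouple.\<close>

lemma mars_resolvent_iff:
  assumes A: "bounded_clinear A" and "m \<ge> 1"
  shows "(\<forall>i. z *\<^sub>C v i - mars_op m A v i = f i) \<longleftrightarrow>
    (\<forall>j<m. v j = z ^ j *\<^sub>C v 0 - horner z f j) \<and>
    mars_pencil m A z (v 0) = horner z f m - (1 / real m) *\<^sub>R A (\<Sum>j<m. horner z f j) \<and>
    (\<forall>i\<ge>m. z *\<^sub>C v i = f i)" (is "?L \<longleftrightarrow> ?R1 \<and> ?R2 \<and> ?R3")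
proof -
  have m: "Suc (m - 1) = m" using assms(2) by simp
  have horner_m: "horner z f m = z *\<^sub>C horner z f (m - 1) + f (m - 1)"
    using horner.simps(2)[of z f "m - 1"] by (simp only: m)
  have "?L \<longleftrightarrow> (\<forall>i<m - 1. z *\<^sub>C v i - mars_op m A v i = f i) \<and>
      z *\<^sub>C v (m - 1) - mars_op m A v (m - 1) = f (m - 1) \<and>
      (\<forall>i\<ge>m. z *\<^sub>C v i - mars_op m A v i = f i)"
    using m by (metis less_antisym not_less)
  also have "(\<forall>i\<ge>m. z *\<^sub>C v i - mars_op m A v i = f i) \<longleftrightarrow> ?R3"
    by (simp add: mars_op_def)
  also have "(\<forall>i<m - 1. z *\<^sub>C v i - mars_op m A v i = f i) \<longleftrightarrow> ?R1"
  proof -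
    have "(\<forall>i<m - 1. z *\<^sub>C v i - mars_op m A v i = f i) \<longleftrightarrow>
        (\<forall>i<m - 1. v (Suc i) = z *\<^sub>C v i - f i)"
      by (auto simp: mars_op_def algebra_simps)
    also have "\<dots> \<longleftrightarrow> ?R1"
    proof
      assume rec: "\<forall>i<m - 1. v (Suc i) = z *\<^sub>C v i - f i"
      have "v j = z ^ j *\<^sub>C v 0 - horner z f j" if "j < m" for j
        using that
      proof (induction j)
        case 0
        show ?case by (simp add: scaleC_one)
      next
        case (Suc j)
        then have "v (Suc j) = z *\<^sub>C (z ^ j *\<^sub>C v 0 - horner z f j) - f j"
          using rec by simp
        then show ?case by (simp add: scaleC.scale_right_diff_distrib scaleC_scaleC)
      qed
      then show ?R1 by blast
    next
      assume R1: ?R1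
      show "\<forall>i<m - 1. v (Suc i) = z *\<^sub>C v i - f i"
      proof (intro allI impI)
        fix i assume "i < m - 1"
        then have i: "Suc i < m" "i < m" by simp_all
        from R1[rule_format, OF i(1)] R1[rule_format, OF i(2)]
        show "v (Suc i) = z *\<^sub>C v i - f i"
          by (simp only: scaleC.scale_right_diff_distrib scaleC_scaleC horner.simps power_Suc) simp
      qed
    qed
    finally show ?thesis .
  qed
  finally have L: "?L \<longleftrightarrow> ?R1 \<and> z *\<^sub>C v (m - 1) - mars_op m A v (m - 1) = f (m - 1) \<and> ?R3" .
  have "z *\<^sub>C v (m - 1) - mars_op m A v (m - 1) = f (m - 1) \<longleftrightarrow> ?R2" if R1: ?R1
  proof -
    have "z *\<^sub>C v (m - 1) - mars_op m A v (m - 1) = mars_pencil m A z (v 0)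
        - z *\<^sub>C horner z f (m - 1) + (1 / real m) *\<^sub>R A (\<Sum>j<m. horner z f j)"
      by (rule mars_op_last_row[OF assms]) (rule R1[rule_format])
    then show ?thesis by (simp only: horner_m) (auto simp: algebra_simps)
  qed
  then show ?thesis using L by blast
qed

text \<open>Both halves of invertibility are read off from the eliminated system. On the entries
  from m on, the operator is multiplication by z, inverted because z is nonzero.\<close>

lemma not_in_op_spectrum_mars_seq_iff:
  fixes A :: "'a::cbanach \<Rightarrow> 'a"
  assumes A: "bounded_clinear A" and m: "m \<ge> 1" and z: "z \<noteq> 0"
  shows "z \<notin> op_spectrum (mars_seq m A) \<longleftrightarrow> bicontinuous (mars_pencil m A z)"
proof -
  let ?R = "\<lambda>v. z *\<^sub>C v - mars_seq m A v"
  have lin: "bounded_linear A" using A by (simp add: bounded_clinear_def)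
  obtain B where B: "B > 0" "\<And>x. norm (A x) \<le> norm x * B"
    using bounded_linear.pos_bounded[OF lin] by blast
  have R_iff: "?R v = f \<longleftrightarrow> (\<forall>i. z *\<^sub>C apply_bcontfun v i - mars_op m A (apply_bcontfun v) i
      = apply_bcontfun f i)" for v f
    by (auto simp: apply_mars_seq intro!: bcontfun_eqI)
  have "bicontinuous ?R \<longleftrightarrow> bicontinuous (mars_pencil m A z)"
  proof
    assume bi: "bicontinuous ?R"
    then obtain K where K: "K > 0" "\<And>v. norm v \<le> K * norm (?R v)"
      using bicontinuous_imp_pos_bound[OF bi] by blast
    show "bicontinuous (mars_pencil m A z)"
    proof (rule bicontinuousI)
      fix y :: 'a
      \<comment> \<open>For data in the last row only, the Horner sums vanish below m and equal y at
        m.\<close>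
      let ?f = "\<lambda>i. if i + 1 = m then y else 0"
      have f: "apply_bcontfun (Bcontfun ?f) = ?f"
        by (rule apply_Bcontfun[of _ m]) (auto simp: prod_space_def)
      obtain v where "?R v = Bcontfun ?f"
        using surjD[OF bicontinuous_imp_surj[OF bi]] by metis
      then have "mars_pencil m A z (apply_bcontfun v 0) =
          horner z ?f m - (1 / real m) *\<^sub>R A (\<Sum>j<m. horner z ?f j)"
        unfolding R_iff f mars_resolvent_iff[OF A m] by blast
      moreover have zero: "horner z ?f j = 0" if "j < m" for j
        using that by (induction j) auto
      moreover have "horner z ?f m = y"
        using zero[of "m - 1"] m horner.simps(2)[of z ?f "m - 1"] by simp
      ultimately have "mars_pencil m A z (apply_bcontfun v 0) = y"
        using linear_0[OF bounded_linear.linear[OF lin]] by simp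
      then show "\<exists>x. mars_pencil m A z x = y" by blast
    next
      fix x :: 'a
      \<comment> \<open>The geometric tuple satisfies every homogeneous row but the last, where the
        pencil at x remains.\<close>
      let ?v = "\<lambda>i. if i < m then z ^ i *\<^sub>C x else 0"
      have v: "apply_bcontfun (Bcontfun ?v) = ?v"
        by (rule apply_Bcontfun[of _ m]) (auto simp: prod_space_def)
      have last: "z *\<^sub>C ?v (m - 1) - mars_op m A ?v (m - 1) = mars_pencil m A z x"
        using mars_op_last_row[OF A m, of ?v z x "\<lambda>_. 0"]
          linear_0[OF bounded_linear.linear[OF lin]] by simp
      have R_v: "apply_bcontfun (?R (Bcontfun ?v)) i = z *\<^sub>C ?v i - mars_op m A ?v i" for i
        by (simp only: apply_mars_seq v minus_bcontfun.rep_eq apply_bcontfun_scaleC)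
      have "norm (apply_bcontfun (?R (Bcontfun ?v)) i) \<le> norm (mars_pencil m A z x)" for i
      proof (cases "i = m - 1")
        case True
        show ?thesis unfolding R_v True last by simp
      next
        case False
        then have "apply_bcontfun (?R (Bcontfun ?v)) i = 0"
          unfolding R_v by (auto simp: mars_op_def scaleC_scaleC)
        then show ?thesis by simp
      qed
      then have "norm (?R (Bcontfun ?v)) \<le> norm (mars_pencil m A z x)" by (rule norm_bound)
      moreover have "norm x \<le> norm (Bcontfun ?v)"
        using norm_bounded[of "Bcontfun ?v" 0] m by (simp add: v scaleC_one)
      ultimately show "norm x \<le> K * norm (mars_pencil m A z x)"
        using K(2)[of "Bcontfun ?v"] K(1) by (meson mult_left_mono less_imp_le order_trans)
    qed
  next
    assume bi: "bicontinuous (mars_pencil m A z)"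
    then obtain K where K: "K > 0" "\<And>x. norm x \<le> K * norm (mars_pencil m A z x)"
      using bicontinuous_imp_pos_bound[OF bi] by blast
    define C where "C = (\<Sum>i<m. cmod z ^ i)"
    have C: "C \<ge> 0" by (simp add: C_def sum_nonneg)
    show "bicontinuous ?R"
    proof (rule bicontinuousI)
      fix f :: "nat \<Rightarrow>\<^sub>C 'a"
      let ?h = "horner z (apply_bcontfun f)"
      obtain x where x: "mars_pencil m A z x = ?h m - (1 / real m) *\<^sub>R A (\<Sum>j<m. ?h j)"
        using surjD[OF bicontinuous_imp_surj[OF bi]] by metis
      \<comment> \<open>The tail of the solution, f divided by z, may have infinite support. It is
        added as a whole sequence, so \<open>?w\<close> subtracts it again below m.\<close>
      let ?w = "\<lambda>i. if i < m then z ^ i *\<^sub>C x - ?h i - inverse z *\<^sub>C apply_bcontfun f i else 0"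
      have w: "apply_bcontfun (Bcontfun ?w) = ?w"
        by (rule apply_Bcontfun[of _ m]) (auto simp: prod_space_def)
      have "?R (Bcontfun ?w + inverse z *\<^sub>C f) = f"
        unfolding R_iff mars_resolvent_iff[OF A m]
        using m z x by (auto simp: w scaleC_scaleC scaleC_one)
      then show "\<exists>v. ?R v = f" by blast
    next
      fix v
      define f where "f = ?R v"
      let ?v = "apply_bcontfun v"
      let ?h = "horner z (apply_bcontfun f)"
      have "(\<forall>j<m. ?v j = z ^ j *\<^sub>C ?v 0 - ?h j) \<and>
          mars_pencil m A z (?v 0) = ?h m - (1 / real m) *\<^sub>R A (\<Sum>j<m. ?h j) \<and>
          (\<forall>i\<ge>m. z *\<^sub>C ?v i = apply_bcontfun f i)"
        using R_iff[THEN iffD1, OF f_def[symmetric]] unfolding mars_resolvent_iff[OF A m] .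
      then have v: "\<And>j. j < m \<Longrightarrow> ?v j = z ^ j *\<^sub>C ?v 0 - ?h j"
        and pencil: "mars_pencil m A z (?v 0) = ?h m - (1 / real m) *\<^sub>R A (\<Sum>j<m. ?h j)"
        and tail: "\<And>i. i \<ge> m \<Longrightarrow> z *\<^sub>C ?v i = apply_bcontfun f i"
        by blast+
      have h: "norm (?h j) \<le> C * norm f" if "j \<le> m" for j
      proof -
        have "norm (?h j) \<le> (\<Sum>i<j. cmod z ^ i) * norm f"
          by (rule norm_horner_le) (rule norm_bounded)
        also have "\<dots> \<le> C * norm f"
          unfolding C_def using that by (intro mult_right_mono sum_mono2) auto
        finally show ?thesis .
      qed
      have "norm (A (\<Sum>j<m. ?h j)) \<le> (\<Sum>j<m. C * norm f) * B"
        using B(1) by (intro order_trans[OF B(2)] mult_right_mono sum_norm_le h) auto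
      then have "norm ((1 / real m) *\<^sub>R A (\<Sum>j<m. ?h j)) \<le> C * norm f * B"
        using m by (simp add: field_simps)
      then have "norm (mars_pencil m A z (?v 0)) \<le> C * norm f + C * norm f * B"
        unfolding pencil using h[of m] by (intro norm_triangle_le_diff add_mono) auto
      then have "norm (?v 0) \<le> K * (C * norm f + C * norm f * B)"
        using K(2)[of "?v 0"] K(1) by (meson mult_left_mono less_imp_le order_trans)
      also have "\<dots> = (K * C * (1 + B)) * norm f" by (simp add: algebra_simps)
      finally have v0: "norm (?v 0) \<le> (K * C * (1 + B)) * norm f" .
      have C_pow: "cmod z ^ i \<le> C" if "i < m" for i
        unfolding C_def using that by (intro member_le_sum) auto
      define D where "D = C * (K * C * (1 + B)) + C"
      have D: "D \<ge> 0" using C K(1) B(1) by (simp add: D_def)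
      show "norm v \<le> (D + 1 / cmod z) * norm f"
      proof (rule norm_bound)
        fix i
        show "norm (?v i) \<le> (D + 1 / cmod z) * norm f"
        proof (cases "i < m")
          case True
          have "norm (?v i) \<le> cmod z ^ i * norm (?v 0) + norm (?h i)"
            using v[OF True] norm_triangle_ineq4[of "z ^ i *\<^sub>C ?v 0" "?h i"]
            by (simp add: norm_scaleC norm_power)
          also have "\<dots> \<le> C * ((K * C * (1 + B)) * norm f) + C * norm f"
            using C v0 True by (intro add_mono mult_mono C_pow h) auto
          also have "\<dots> = D * norm f" by (simp add: D_def algebra_simps)
          also have "\<dots> \<le> (D + 1 / cmod z) * norm f" by (intro mult_right_mono) auto
          finally show ?thesis .
        next
          case False
          have "cmod z * norm (?v i) = norm (apply_bcontfun f i)"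
            using tail[of i] False by (simp flip: norm_scaleC)
          also have "\<dots> \<le> norm f" by (rule norm_bounded)
          finally have "norm (?v i) \<le> 1 / cmod z * norm f" using z by (simp add: field_simps)
          also have "\<dots> \<le> (D + 1 / cmod z) * norm f" using D by (intro mult_right_mono) auto
          finally show ?thesis .
        qed
      qed
    qed
  qed
  then show ?thesis
    by (simp only: not_in_op_spectrum_iff[OF bounded_clinear_mars_seq[OF A]])
qed

text \<open>Only points outside the open disk matter; they are nonzero, so elimination applies to
  them.\<close>

lemma op_spectrum_mars_seq_subset_iff:
  assumes A: "bounded_clinear A" and m: "m \<ge> 1"
  shows "op_spectrum (mars_seq m A) \<subseteq> {z. cmod z < 1} \<longleftrightarrow> op_spectrum A \<subseteq> MARS m"
proof -
  have "z \<notin> op_spectrum (mars_seq m A) \<longleftrightarrow> (\<forall>a\<in>op_spectrum A. z \<notin> spectrum (mars_mat m a))"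
    if "\<not> cmod z < 1" for z
  proof -
    have z: "z \<noteq> 0" using that by auto
    show ?thesis
      by (simp only: not_in_op_spectrum_mars_seq_iff[OF A m z] mars_pencil_bicontinuous_iff[OF A m z]
          spectrum_mars_mat_iff[OF m])
  qed
  then show ?thesis by (fastforce simp: MARS_def)
qed

section \<open>Comparison of the operator norms\<close>

lemma mars_op_funpow_in_prod_space:
  "v \<in> prod_space m \<Longrightarrow> (mars_op m A ^^ n) v \<in> prod_space m"
  by (cases n) (simp_all add: mars_op_in_prod_space)

text \<open>On tuples, \<open>N\<close>, the 1-norm and the supremum norm are equivalent, so for n
  >= 1 each operator norm is at most b * m / a times the other.\<close>

lemma op_norm_tendsto_0_iff:
  fixes A :: "'a::cbanach \<Rightarrow> 'a"
  assumes A: "bounded_clinear A" and m: "m \<ge> 1" and N: "product_norm m N"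
  shows "(\<lambda>n. op_norm m N (mars_op m A ^^ n)) \<longlonglongrightarrow> 0 \<longleftrightarrow>
    (\<lambda>n. onorm (mars_seq m A ^^ n)) \<longlonglongrightarrow> 0"
proof -
  let ?S = "\<lambda>v :: nat \<Rightarrow> 'a. \<Sum>i<m. norm (v i)"
  let ?M = "\<lambda>n. mars_op m A ^^ n"
  let ?T = "\<lambda>n. mars_seq m A ^^ n"
  have clin: "bounded_clinear (?T n)" for n
    by (rule bounded_clinear_funpow[OF bounded_clinear_mars_seq[OF A]])
  then have lin: "bounded_linear (?T n)" and scale: "?T n (c *\<^sub>C v) = c *\<^sub>C ?T n v" for n c v
    by (auto simp: bounded_clinear_def)
  obtain a b0 where a: "a > 0" "\<And>v. v \<in> prod_space m \<Longrightarrow> a * ?S v \<le> N v"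
    and b0: "\<And>v. v \<in> prod_space m \<Longrightarrow> N v \<le> b0 * ?S v"
    using N unfolding product_norm_def by blast
  \<comment> \<open>The constant from \<open>product_norm\<close> carries no sign; the maximum makes
    it positive.\<close>
  define b where "b = max b0 1"
  have b: "N v \<le> b * ?S v" if "v \<in> prod_space m" for v
    using order_trans[OF b0[OF that] mult_right_mono[of b0 b "?S v"]]
    by (auto simp: b_def sum_nonneg)
  have b_pos: "b > 0" by (simp add: b_def)
  have N_scale: "N (\<lambda>i. c *\<^sub>C v i) = cmod c * N v" if "v \<in> prod_space m" for c v
    using N that by (simp add: product_norm_def)
  have N_nonneg: "N v \<ge> 0" if "v \<in> prod_space m" for v
    using a(1) by (intro order_trans[OF _ a(2)[OF that]]) (simp add: sum_nonneg)
  have S_le: "?S (apply_bcontfun v) \<le> real m * norm v" for v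
    using sum_bounded_above[of "{..<m}" "\<lambda>i. norm (apply_bcontfun v i)" "norm v"]
    by (simp add: norm_bounded)
  have norm_le_S: "norm v \<le> ?S (apply_bcontfun v)" if "apply_bcontfun v \<in> prod_space m" for v
  proof (rule norm_bound)
    fix i
    show "norm (apply_bcontfun v i) \<le> ?S (apply_bcontfun v)"
    proof (cases "i < m")
      case True
      then show ?thesis by (intro member_le_sum) auto
    next
      case False
      then show ?thesis using that by (simp add: prod_space_def sum_nonneg)
    qed
  qed
  have M: "?M n v = apply_bcontfun (?T n (Bcontfun v))" if "v \<in> prod_space m" for n v
    by (simp add: apply_mars_seq_funpow apply_Bcontfun[OF that])
  have M_in: "?M n v \<in> prod_space m" if "v \<in> prod_space m" for n v
    using that by (rule mars_op_funpow_in_prod_space)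
  have upper: "N (?M n v) \<le> (b * m * onorm (?T n)) * ?S v" if v: "v \<in> prod_space m" for n v
  proof -
    have "N (?M n v) \<le> b * ?S (?M n v)" by (rule b[OF M_in[OF v]])
    also have "\<dots> \<le> b * (m * (onorm (?T n) * norm (Bcontfun v)))"
      unfolding M[OF v] using b_pos
      by (intro mult_left_mono order_trans[OF S_le] onorm[OF lin]) auto
    also have "\<dots> \<le> b * (m * (onorm (?T n) * ?S v))"
      using norm_le_S[of "Bcontfun v"] v b_pos onorm_pos_le[OF lin]
      by (intro mult_left_mono) (auto simp: apply_Bcontfun[OF v])
    finally show ?thesis by (simp add: mult_ac)
  qed
  have unit_le: "N (?M n v) \<le> (b * m / a) * onorm (?T n)" if v: "v \<in> prod_space m" "N v \<le> 1" for n v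
  proof -
    have "?S v \<le> 1 / a" using a(1) a(2)[OF v(1)] v(2) by (simp add: field_simps)
    then have "(b * m * onorm (?T n)) * ?S v \<le> (b * m * onorm (?T n)) * (1 / a)"
      using b_pos onorm_pos_le[OF lin] by (intro mult_left_mono) auto
    then show ?thesis using upper[OF v(1), of n] by (simp add: mult_ac)
  qed
  \<comment> \<open>\<open>unit_le\<close> bounds the set under the supremum, so its elements lie
    below \<open>op_norm\<close>.\<close>
  have le_op_norm: "N (?M n v) \<le> op_norm m N (?M n)" if "v \<in> prod_space m" "N v \<le> 1" for n v
    unfolding op_norm_def using that unit_le by (intro cSUP_upper) (auto intro!: bdd_aboveI2)
  have zero: "(\<lambda>_. 0) \<in> prod_space m" "N (\<lambda>_. 0) = 0"
    using N_scale[of "\<lambda>_. 0" 0] by (simp_all add: prod_space_def)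
  have op_norm_nonneg: "op_norm m N (?M n) \<ge> 0" for n
    using le_op_norm[OF zero(1), of n] N_nonneg[OF M_in[OF zero(1)], of n] zero(2) by simp
  have op_norm_le: "op_norm m N (?M n) \<le> (b * m / a) * onorm (?T n)" for n
    unfolding op_norm_def using zero unit_le by (intro cSUP_least) auto
  have N_M_le: "N (?M n v) \<le> op_norm m N (?M n) * N v" if v: "v \<in> prod_space m" for n v
  proof (cases "N v = 0")
    case True
    \<comment> \<open>No rescaling to the unit ball is possible here; the lower bound on
      \<open>N\<close> gives \<open>?S v = 0\<close>, and \<open>upper\<close> then
      suffices.\<close>
    then have "?S v = 0" using a(1) a(2)[OF v] sum_nonneg[of "{..<m}" "\<lambda>i. norm (v i)"]
      by (simp add: mult_le_0_iff)
    then show ?thesis using upper[OF v, of n] True by simp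
  next
    case False
    then have Nv: "N v > 0" using N_nonneg[OF v] by simp
    define c where "c = complex_of_real (1 / N v)"
    have c: "cmod c = 1 / N v" using Nv by (simp add: c_def norm_divide)
    let ?u = "\<lambda>i. c *\<^sub>C v i"
    have u: "?u \<in> prod_space m" using v by (simp add: prod_space_def)
    have "Bcontfun ?u = c *\<^sub>C Bcontfun v"
      by (rule bcontfun_eqI) (simp add: apply_Bcontfun[OF u] apply_Bcontfun[OF v])
    then have "?M n ?u = (\<lambda>i. c *\<^sub>C ?M n v i)"
      by (auto simp: M[OF u] M[OF v] scale)
    moreover have "N (?M n ?u) \<le> op_norm m N (?M n)"
      by (rule le_op_norm[OF u]) (simp add: N_scale[OF v] c Nv)
    ultimately show ?thesis
      using Nv by (simp add: N_scale[OF M_in[OF v]] c field_simps)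
  qed
  have onorm_le: "onorm (?T n) \<le> (b * m / a) * op_norm m N (?M n)" if "n \<ge> 1" for n
  proof (rule onorm_bound)
    fix v :: "nat \<Rightarrow>\<^sub>C 'a"
    \<comment> \<open>\<open>mars_op\<close> reads only the first m entries, so one application
      already forgets the tail; for n = 0 the identity would keep it.\<close>
    define u where "u = (\<lambda>i. if i < m then apply_bcontfun v i else 0)"
    have u: "u \<in> prod_space m" by (simp add: u_def prod_space_def)
    have "mars_op m A (apply_bcontfun v) = mars_op m A u"
      by (auto simp: mars_op_def u_def)
    then have Tv: "apply_bcontfun (?T n v) = ?M n u"
      using that by (cases n) (simp_all add: apply_mars_seq apply_mars_seq_funpow funpow_Suc_right del: funpow.simps)
    have "norm (?T n v) \<le> ?S (?M n u)"
      using norm_le_S[of "?T n v"] M_in[OF u] by (simp add: Tv)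
    also have "\<dots> \<le> N (?M n u) / a"
      using a(1) a(2)[OF M_in[OF u]] by (simp add: field_simps)
    also have "\<dots> \<le> op_norm m N (?M n) * (b * (m * norm v)) / a"
    proof (rule divide_right_mono)
      have "N u \<le> b * ?S u" by (rule b[OF u])
      also have "\<dots> \<le> b * (m * norm v)"
        using S_le[of v] b_pos by (intro mult_left_mono) (auto simp: u_def)
      finally show "N (?M n u) \<le> op_norm m N (?M n) * (b * (m * norm v))"
        using op_norm_nonneg by (intro order_trans[OF N_M_le[OF u]] mult_left_mono)
    qed (use a in simp)
    finally show "norm (?T n v) \<le> (b * m / a) * op_norm m N (?M n) * norm v"
      by (simp add: mult_ac)
  qed (use a b_pos op_norm_nonneg in simp)
  show ?thesis
  proof
    assume "(\<lambda>n. op_norm m N (?M n)) \<longlonglongrightarrow> 0"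
    then have "(\<lambda>n. (b * m / a) * op_norm m N (?M n)) \<longlonglongrightarrow> 0"
      by (rule tendsto_mult_right_zero)
    then show "(\<lambda>n. onorm (?T n)) \<longlonglongrightarrow> 0"
      by (rule tendsto_sandwich[OF _ _ tendsto_const, rotated 2])
        (use onorm_le onorm_pos_le[OF lin] in \<open>auto simp: eventually_sequentially\<close>)
  next
    assume "(\<lambda>n. onorm (?T n)) \<longlonglongrightarrow> 0"
    then have "(\<lambda>n. (b * m / a) * onorm (?T n)) \<longlonglongrightarrow> 0"
      by (rule tendsto_mult_right_zero)
    then show "(\<lambda>n. op_norm m N (?M n)) \<longlonglongrightarrow> 0"
      by (rule tendsto_sandwich[OF _ _ tendsto_const, rotated 2])
        (use op_norm_le op_norm_nonneg in auto)
  qed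
qed

theorem theorem11p1:
  fixes A :: "'a::cbanach \<Rightarrow> 'a" and m :: nat
    and N :: "(nat \<Rightarrow> 'a) \<Rightarrow> real"
  assumes "bounded_clinear A"
    and "m \<ge> 1"
    and "product_norm m N"
  shows "((\<lambda>n. op_norm m N (mars_op m A ^^ n)) \<longlonglongrightarrow> 0) \<longleftrightarrow> op_spectrum A \<subseteq> MARS m"
  using op_norm_tendsto_0_iff[OF assms] onorm_funpow_tendsto_0_iff[OF bounded_clinear_mars_seq[OF assms(1)]]
    op_spectrum_mars_seq_subset_iff[OF assms(1,2)]
  by simp

end
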